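(* Let $(P_\theta)_{\theta\in\Theta}$ be a statistical model on $(\Omega,\mathcal{F})$ such that the parameter set $\Theta$ is finite and any two different probability measures among the $P_\theta$ are mutually singular. Let $(\mathcal{F}'_n)$ be a filtration with $\mathcal{F}'_n\subseteq\mathcal{F}_n$ for all $n$, where $(\mathcal{F}_n)$ is the natural filtration, and let $(S^\theta)_{\theta\in\Theta}$ be a family such that, for each $\theta\in\Theta$, $S^\theta$ is a test martingale with respect to $(\mathcal{F}'_n)$ and $P_\theta$. Let $\epsilon>0$. Then there exists a family $(\tilde S^\theta)_{\theta\in\Theta}$ such that, for each $\theta\in\Theta$, $\tilde S^\theta$ is a natural test martingale with respect to $P_\theta$, and $$\liminf_{n\to\infty}\inf_{\theta\in\Theta}\tilde S^\theta_n\ \ge\ (1-\epsilon)\limsup_{n\to\infty}\inf_{\theta\in\Theta}S^\theta_n$$ almost surely under $P_{\theta_0}$ for every $\theta_0\in\Theta$.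
   Context: $(\Omega,\mathcal{F})$ is a measurable space and $(P_\theta)_{\theta\in\Theta}$ is a family of probability measures on it (the statistical model), with $\Theta$ nonempty. $Z_1,Z_2,\dots$ are random elements on $(\Omega,\mathcal{F})$ with values in a measurable space $\mathbf{Z}$ (the observations). The natural filtration is $\mathcal{F}_n:=\sigma(Z_1,\dots,Z_n)$, $n=0,1,\dots$ ($\mathcal{F}_0$ is trivial). A filtration is an increasing sequence of $\sigma$-algebras. A test martingale with respect to a filtration and a probability measure $P$ is a nonnegative martingale $(S_n)_{n\ge0}$ with respect to that filtration and $P$ with $S_0=1$; it is called natural if the filtration is the natural filtration $(\mathcal{F}_n)$. The limits inferior and superior take values in $[0,\infty]$. *)

theory Defs
  imports "HOL-Probability.Probability"
begin

definition mutually_singular :: "'a measure \<Rightarrow> 'a measure \<Rightarrow> bool" where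
  "mutually_singular \<mu> \<nu> \<longleftrightarrow> sets \<mu> = sets \<nu> \<and>
     (\<exists>A\<in>sets \<mu>. emeasure \<mu> A = 0 \<and> emeasure \<nu> (space \<nu> - A) = 0)"

text \<open>The observations are indexed from 1; the value \<open>Z 0\<close> is never used. The result carries the
  null measure: only its \<open>\<sigma>\<close>-algebra matters, as for the filtrations in
  \<open>HOL-Probability.Stopping_Time\<close>.\<close>

definition natural_filtration ::
  "'a measure \<Rightarrow> 'z measure \<Rightarrow> (nat \<Rightarrow> 'a \<Rightarrow> 'z) \<Rightarrow> nat \<Rightarrow> 'a measure" where
  "natural_filtration M N Z n =
     sigma (space M) {Z i -` A \<inter> space M | i A. i \<in> {1..n} \<and> A \<in> sets N}"

definition martingale :: "'a measure \<Rightarrow> (nat \<Rightarrow> 'a measure) \<Rightarrow> (nat \<Rightarrow> 'a \<Rightarrow> real) \<Rightarrow> bool" where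
  "martingale P F S \<longleftrightarrow>
     filtration (space P) F \<and> (\<forall>n. subalgebra P (F n)) \<and>
     (\<forall>n. S n \<in> borel_measurable (F n)) \<and> (\<forall>n. integrable P (S n)) \<and>
     (\<forall>m n. m \<le> n \<longrightarrow> (AE \<omega> in P. real_cond_exp P (F m) (S n) \<omega> = S m \<omega>))"

text \<open>Nonnegativity and the initial value are required at every point of the sample space, not just
  almost surely; processes are compared under measures singular to \<open>P\<close>.\<close>

definition test_martingale :: "'a measure \<Rightarrow> (nat \<Rightarrow> 'a measure) \<Rightarrow> (nat \<Rightarrow> 'a \<Rightarrow> real) \<Rightarrow> bool" where
  "test_martingale P F S \<longleftrightarrow>
     martingale P F S \<and> (\<forall>n. \<forall>\<omega>\<in>space P. 0 \<le> S n \<omega>) \<and> (\<forall>\<omega>\<in>space P. S 0 \<omega> = 1)"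

end

theory Submission
  imports Defs
begin

text \<open>
  The martingales are compared one parameter at a time, and at every sample point. Fix a
  probability measure \<open>P\<close> and a test martingale \<open>S\<close> for a filtration \<open>F\<close> that is coarser than \<open>G\<close>,
  where \<open>G 0\<close> is trivial. The claim is that some \<open>G\<close>-test martingale \<open>S'\<close> satisfies
  \<open>limsup S \<le> (1 + \<epsilon>) * liminf S'\<close> everywhere (\<open>test_martingale_refine_filtration\<close>). For a finite
  parameter set the lower limit of a minimum is the minimum of the lower limits, and
  \<open>(1 - \<epsilon>) * (1 + \<epsilon>) \<le> 1\<close>, so the theorem follows.

  Let \<open>X = limsup S\<close>, with values in \<open>[0, \<infinity>]\<close>. It is measurable for the \<open>\<sigma>\<close>-algebra generated by
  all the \<open>F n\<close>, and three facts give \<open>S'\<close>.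

  First, \<open>X\<close> has integral at most 1 (\<open>nn_integral_limsup_test_martingale\<close>). This would follow from
  the martingale convergence theorem and Fatou's lemma; here it is obtained from a maximal
  inequality instead: if \<open>W\<close> is \<open>F m\<close>-measurable, then stopping \<open>S\<close> when it first reaches \<open>W\<close> after
  time \<open>m\<close> shows that the integral of \<open>W\<close> over the event that this ever happens is at most 1. One
  applies it to functions \<open>W\<close> that approximate \<open>X\<close> and lie below it outside a small event.

  Second, \<open>X\<close> is dominated, everywhere, by the limit of an increasing adapted sequence \<open>Y\<close> of
  real functions with integrals at most \<open>1 + \<epsilon>\<close> (\<open>increasing_adapted_majorant\<close>). This is outer
  regularity: every set in the generated \<open>\<sigma>\<close>-algebra is covered, at an arbitrarily small cost in
  probability, by a countable union of sets from the \<open>F n\<close>. In particular, the null set on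
  which \<open>X\<close> is infinite is inside a set on which \<open>Y\<close> tends to infinity, so the domination is not
  affected by null sets and holds under any other measure.

  Third, let \<open>y = lim Y\<close>, and let \<open>S'\<close> be \<open>max (Y n) (E[y | G n])\<close> divided by \<open>E[y]\<close>. Almost surely
  the maximum is just the conditional expectation, so \<open>S'\<close> is a martingale, but it now lies above
  \<open>Y n / (1 + \<epsilon>)\<close> everywhere (\<open>test_martingale_above_increasing\<close>). Since \<open>Y\<close> increases to a
  majorant of \<open>X\<close>, the lower limit of \<open>S'\<close> is at least \<open>X / (1 + \<epsilon>)\<close>.
\<close>

section \<open>Countable unions of adapted events\<close>

locale filtered_prob_space = prob_space P + filtration "space P" F
  for P :: "'a measure" and F :: "nat \<Rightarrow> 'a measure" +
  assumes subalgebra_F: "subalgebra P (F n)"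
begin

lemma sets_F_subset: "sets (F n) \<subseteq> sets P"
  using subalgebra_F unfolding subalgebra_def by blast

lemma in_sets_F_mono: "A \<in> sets (F m) \<Longrightarrow> m \<le> n \<Longrightarrow> A \<in> sets (F n)"
  using sets_F_mono by blast

lemma measurable_F_imp_measurable: "f \<in> measurable (F n) N \<Longrightarrow> f \<in> measurable P N"
  by (rule measurable_from_subalg[OF subalgebra_F])

lemma measurable_F_mono: "m \<le> n \<Longrightarrow> f \<in> measurable (F m) N \<Longrightarrow> f \<in> measurable (F n) N"
  by (rule measurable_from_subalg[of "F n" "F m"]) (simp_all add: subalgebra_def space_F sets_F_mono)

lemma finite_measure_subalgebra_F: "finite_measure_subalgebra P (F n)"
  using subalgebra_F by unfold_locales

text \<open>These sets play the role of the open sets in outer regularity. Because the filtration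
  increases, it makes no difference whether the \<open>n\<close>-th set is taken from \<open>F n\<close> or from any of the
  \<open>\<sigma>\<close>-algebras; indexing by \<open>n\<close> is what later makes the majorant an adapted sequence.\<close>

definition adapted_union :: "'a set \<Rightarrow> bool" where
  "adapted_union U \<longleftrightarrow> (\<exists>C. (\<forall>n. C n \<in> sets (F n)) \<and> U = (\<Union>n. C n))"

lemma adapted_union_in_sets: "adapted_union U \<Longrightarrow> U \<in> sets P"
  using sets_F_subset unfolding adapted_union_def by auto

lemma adapted_union_basic:
  assumes "A \<in> sets (F k)"
  shows "adapted_union A"
proof -
  define C where "C n = (if k \<le> n then A else {})" for n
  have "C n \<in> sets (F n)" for n
    using assms sets_F_mono[of k n] by (auto simp: C_def)
  moreover have "A = (\<Union>n. C n)"
    by (auto simp: C_def split: if_splits)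
  ultimately show ?thesis
    unfolding adapted_union_def by blast
qed

lemma adapted_union_UN:
  assumes "\<And>i::nat. adapted_union (U i)"
  shows "adapted_union (\<Union>i. U i)"
proof -
  obtain C where C: "\<And>i n. C i n \<in> sets (F n)" "\<And>i. U i = (\<Union>n. C i n)"
    using assms unfolding adapted_union_def by metis
  define D where "D N = (\<Union>i\<le>N. \<Union>n\<le>N. C i n)" for N
  have "D N \<in> sets (F N)" for N
    unfolding D_def by (intro sets.finite_UN) (auto intro: in_sets_F_mono[OF C(1)])
  moreover have "(\<Union>i. U i) = (\<Union>N. D N)"
  proof
    show "(\<Union>i. U i) \<subseteq> (\<Union>N. D N)"
    proof
      fix x assume "x \<in> (\<Union>i. U i)"
      then obtain i n where "x \<in> C i n" using C(2) by auto
      then have "x \<in> D (max i n)" unfolding D_def by force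
      then show "x \<in> (\<Union>N. D N)" by blast
    qed
  qed (auto simp: D_def C(2))
  ultimately show ?thesis
    unfolding adapted_union_def by blast
qed

lemma adapted_union_Int:
  assumes "adapted_union U" "adapted_union V"
  shows "adapted_union (U \<inter> V)"
proof -
  obtain C where C: "\<And>n. C n \<in> sets (F n)" "U = (\<Union>n. C n)"
    using assms(1) unfolding adapted_union_def by metis
  obtain D where D: "\<And>n. D n \<in> sets (F n)" "V = (\<Union>n. D n)"
    using assms(2) unfolding adapted_union_def by metis
  have "adapted_union (C m \<inter> D n)" for m n
    using C(1)[of m] D(1)[of n] sets_F_mono[of m "max m n"] sets_F_mono[of n "max m n"]
    by (intro adapted_union_basic[of _ "max m n"]) auto
  then have "adapted_union (\<Union>m. \<Union>n. C m \<inter> D n)"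
    by (intro adapted_union_UN)
  moreover have "U \<inter> V = (\<Union>m. \<Union>n. C m \<inter> D n)"
    by (auto simp: C D)
  ultimately show ?thesis by simp
qed

lemma adapted_union_INT_finite:
  assumes "\<And>i. adapted_union (V i)"
  shows "adapted_union (\<Inter>i\<le>(N::nat). V i)"
proof (induction N)
  case 0
  then show ?case using assms by simp
next
  case (Suc N)
  then show ?case using assms by (simp add: atMost_Suc adapted_union_Int)
qed

text \<open>The sets that can be covered from outside at a small cost are not visibly closed under
  complements. The property that a set and its complement have covers with a small overlap is
  symmetric, so only countable unions need an argument. There the intersection of the covers of
  the complements need not be an adapted union, but its finite truncations are, and continuity
  from above makes one of them good enough.\<close>

lemma two_sided_cover:
  assumes "A \<in> sigma_sets (space P) (\<Union>n. sets (F n))" and "0 < e"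
  shows "\<exists>U V. adapted_union U \<and> adapted_union V \<and> A \<subseteq> U \<and> space P - A \<subseteq> V \<and> prob (U \<inter> V) < e"
  using assms
proof (induction arbitrary: e rule: sigma_sets.induct)
  case (Basic A)
  then obtain k where k: "A \<in> sets (F k)" by blast
  then have "space P - A \<in> sets (F k)"
    using sets.compl_sets[of A "F k"] by (simp add: space_F)
  with k Basic show ?case
    by (intro exI[of _ A] exI[of _ "space P - A"]) (auto intro: adapted_union_basic)
next
  case Empty
  have "space P \<in> sets (F 0)"
    using sets.top[of "F 0"] by (simp add: space_F)
  with Empty show ?case
    by (intro exI[of _ "{}"] exI[of _ "space P"]) (auto intro: adapted_union_basic[of _ 0])
next
  case (Compl A)
  then obtain U V where "adapted_union U" "adapted_union V" "A \<subseteq> U" "space P - A \<subseteq> V"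
    "prob (U \<inter> V) < e" by blast
  then show ?case
    by (intro exI[of _ V] exI[of _ U]) (auto simp: Int_commute)
next
  case (Union A)
  have "\<forall>i. \<exists>U V. adapted_union U \<and> adapted_union V \<and> A i \<subseteq> U \<and> space P - A i \<subseteq> V
    \<and> prob (U \<inter> V) < e / 2 * (1/2) ^ Suc i"
    using Union by (intro allI Union.IH) auto
  then obtain U V where UV: "\<And>i. adapted_union (U i)" "\<And>i. adapted_union (V i)"
    "\<And>i. A i \<subseteq> U i" "\<And>i. space P - A i \<subseteq> V i"
    "\<And>i. prob (U i \<inter> V i) < e / 2 * (1/2) ^ Suc i" by metis
  note [measurable] = UV(1,2)[THEN adapted_union_in_sets]
  define W where "W N = (\<Inter>i\<le>N. V i)" for N :: nat
  have W: "adapted_union (W N)" for N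
    unfolding W_def by (rule adapted_union_INT_finite[OF UV(2)])
  note [measurable] = W[THEN adapted_union_in_sets]
  have "(\<lambda>i. e / 2 * (1/2) ^ Suc i) sums (e / 2 * 1)"
    by (intro sums_mult power_half_series)
  then have tot: "summable (\<lambda>i. e / 2 * (1/2) ^ Suc i)" "(\<Sum>i. e / 2 * (1/2) ^ Suc i) = e / 2"
    by (auto simp: sums_iff)
  have summ: "summable (\<lambda>i. prob (U i \<inter> V i))"
    by (rule summable_comparison_test'[OF tot(1), of 0]) (use UV(5) in \<open>auto intro: less_imp_le\<close>)
  have "prob ((\<Union>i. U i) \<inter> (\<Inter>i. V i)) \<le> prob (\<Union>i. U i \<inter> V i)"
    by (intro finite_measure_mono) auto
  also have "\<dots> \<le> (\<Sum>i. prob (U i \<inter> V i))"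
    by (intro finite_measure_subadditive_countably summ) auto
  also have "\<dots> \<le> (\<Sum>i. e / 2 * (1/2) ^ Suc i)"
    by (intro suminf_le summ tot) (use UV(5) in \<open>auto intro: less_imp_le\<close>)
  also have "\<dots> < e" using tot Union.prems by simp
  finally have small: "prob ((\<Union>i. U i) \<inter> (\<Inter>i. V i)) < e" .
  have "(\<lambda>N. prob ((\<Union>i. U i) \<inter> W N)) \<longlonglongrightarrow> prob (\<Inter>N. (\<Union>i. U i) \<inter> W N)"
    by (intro finite_Lim_measure_decseq) (auto simp: decseq_def W_def)
  moreover have "(\<Inter>N. (\<Union>i. U i) \<inter> W N) = (\<Union>i. U i) \<inter> (\<Inter>i. V i)"
    by (auto simp: W_def)
  ultimately have "eventually (\<lambda>N. prob ((\<Union>i. U i) \<inter> W N) < e) sequentially"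
    using small by (auto intro: order_tendstoD)
  then obtain N where N: "prob ((\<Union>i. U i) \<inter> W N) < e"
    by (auto dest: eventually_happens)
  have "space P - (\<Union>i. A i) \<subseteq> W N"
    using UV(4) by (auto simp: W_def)
  moreover have "(\<Union>i. A i) \<subseteq> (\<Union>i. U i)" using UV(3) by blast
  ultimately show ?case
    using N W adapted_union_UN[of U] UV(1) by blast
qed

text \<open>The proof discretises the layer cake formula: if \<open>A k\<close> is the event \<open>X > (k + 1) * d\<close>, then
  \<open>d * (\<Sum>k. indicator (A k))\<close> lies between \<open>X - d\<close> and \<open>X\<close>, and it is infinite exactly where \<open>X\<close>
  is. Enlarging each \<open>A k\<close> to an adapted union costs a summable amount and yields a sum that is an
  increasing limit of adapted functions.\<close>

lemma increasing_adapted_majorant: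
  fixes X :: "'a \<Rightarrow> ennreal"
  assumes X: "X \<in> borel_measurable (sigma (space P) (\<Union>n. sets (F n)))" and "0 < e"
  obtains Y :: "nat \<Rightarrow> 'a \<Rightarrow> real" where
    "\<And>n. Y n \<in> borel_measurable (F n)"
    "\<And>n \<omega>. 0 < Y n \<omega>"
    "\<And>\<omega>. incseq (\<lambda>n. Y n \<omega>)"
    "\<And>\<omega>. \<omega> \<in> space P \<Longrightarrow> X \<omega> \<le> (SUP n. ennreal (Y n \<omega>))"
    "\<And>n. (\<integral>\<^sup>+\<omega>. Y n \<omega> \<partial>P) \<le> (\<integral>\<^sup>+\<omega>. X \<omega> \<partial>P) + ennreal e"
proof -
  \<comment> \<open>One half of the error pays for the additive constant \<open>d\<close>, the other for enlarging the sets.\<close>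
  define d where "d = e / 2"
  have d: "0 < d" using \<open>0 < e\<close> by (simp add: d_def)
  have gen: "(\<Union>n. sets (F n)) \<subseteq> Pow (space P)"
    using sets_F_subset sets.sets_into_space by blast
  have sub: "sets (sigma (space P) (\<Union>n. sets (F n))) \<subseteq> sets P"
    using sets_F_subset by (subst sets_measure_of[OF gen]) (intro sets.sigma_sets_subset, blast)
  have XP[measurable]: "X \<in> borel_measurable P"
    using X by (rule measurable_from_subalg[rotated]) (use sub gen in \<open>simp add: subalgebra_def\<close>)
  define A where "A k = {\<omega>\<in>space P. ennreal (real (Suc k) * d) < X \<omega>}" for k
  have [measurable]: "A k \<in> sets P" for k unfolding A_def by measurable
  have A: "A k \<in> sigma_sets (space P) (\<Union>n. sets (F n))" for k
  proof -
    have "{\<omega> \<in> space (sigma (space P) (\<Union>n. sets (F n))). ennreal (real (Suc k) * d) < X \<omega>}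
        \<in> sets (sigma (space P) (\<Union>n. sets (F n)))"
      using X by measurable
    then show ?thesis by (simp add: A_def sets_measure_of[OF gen] space_measure_of[OF gen])
  qed
  have "\<forall>k. \<exists>C. (\<forall>n. C n \<in> sets (F n)) \<and> A k \<subseteq> (\<Union>n. C n) \<and>
      prob ((\<Union>n. C n) - A k) < (1/2) ^ Suc k"
  proof
    fix k
    obtain U V where UV: "adapted_union U" "adapted_union V" "A k \<subseteq> U" "space P - A k \<subseteq> V"
      "prob (U \<inter> V) < (1/2) ^ Suc k" using two_sided_cover[OF A, of "(1/2) ^ Suc k" k] by auto
    note [measurable] = UV(1,2)[THEN adapted_union_in_sets]
    have "U - A k \<subseteq> U \<inter> V"
      using UV(4) sets.sets_into_space[OF adapted_union_in_sets[OF UV(1)]] by auto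
    then have "prob (U - A k) \<le> prob (U \<inter> V)" by (intro finite_measure_mono) auto
    with UV show "\<exists>C. (\<forall>n. C n \<in> sets (F n)) \<and> A k \<subseteq> (\<Union>n. C n) \<and>
      prob ((\<Union>n. C n) - A k) < (1/2) ^ Suc k"
      unfolding adapted_union_def by (metis order.strict_trans1)
  qed
  then obtain C where C: "\<And>k n. C k n \<in> sets (F n)" "\<And>k. A k \<subseteq> (\<Union>n. C k n)"
      "\<And>k. prob ((\<Union>n. C k n) - A k) < (1/2) ^ Suc k"
    by metis
  have CP[measurable]: "C k n \<in> sets P" for k n using C(1) sets_F_subset by blast
  define D where "D k n = (\<Union>m\<le>n. C k m)" for k n :: nat
  have D: "D k n \<in> sets (F n)" for k n
    unfolding D_def by (intro sets.finite_UN) (auto intro: in_sets_F_mono[OF C(1)])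
  have DP[measurable]: "D k n \<in> sets P" for k n using D sets_F_subset by blast
  have D_mono: "D k m \<subseteq> D k n" if "m \<le> n" for k m n
    using that unfolding D_def by (intro UN_mono) auto
  define Y where "Y n \<omega> = d + d * (\<Sum>k<n. indicator (D k n) \<omega>)" for n \<omega>
  show thesis
  proof
    show "Y n \<in> borel_measurable (F n)" for n
      unfolding Y_def using D by measurable
    show "0 < Y n \<omega>" for n \<omega>
      unfolding Y_def using d by (intro add_pos_nonneg mult_nonneg_nonneg sum_nonneg) auto
    show "incseq (\<lambda>n. Y n \<omega>)" for \<omega>
    proof (rule incseq_SucI)
      fix n
      have "(\<Sum>k<n. indicator (D k n) \<omega> :: real) \<le> (\<Sum>k<n. indicator (D k (Suc n)) \<omega>)"
        using D_mono[of n "Suc n"] by (intro sum_mono) (auto simp: indicator_def)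
      also have "\<dots> \<le> (\<Sum>k<Suc n. indicator (D k (Suc n)) \<omega>)" by simp
      finally show "Y n \<omega> \<le> Y (Suc n) \<omega>" unfolding Y_def using d by simp
    qed
    show "X \<omega> \<le> (SUP n. ennreal (Y n \<omega>))" if \<omega>: "\<omega> \<in> space P" for \<omega>
    proof (rule dense_le)
      fix y assume y: "y < X \<omega>"
      then obtain r where r: "y = ennreal r" "0 \<le> r"
        by (cases y) (auto simp: top_unique)
      define K where "K = nat \<lfloor>r / d\<rfloor>"
      have K: "real K * d \<le> r" "r < real K * d + d"
      proof -
        have "0 \<le> r / d" using r d by simp
        then have "real K = of_int \<lfloor>r / d\<rfloor>" unfolding K_def by simp
        then have "real K \<le> r / d" "r / d < real K + 1" by linarith+
        then show "real K * d \<le> r" "r < real K * d + d" using d by (auto simp: field_simps)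
      qed
      have "\<exists>n. \<omega> \<in> C k n" if "k < K" for k
      proof -
        have "real (Suc k) * d \<le> real K * d"
          using that d by (intro mult_right_mono) auto
        then have "real (Suc k) * d \<le> r" using K by linarith
        then have "ennreal (real (Suc k) * d) < X \<omega>"
          using y r by (metis ennreal_leI order.strict_trans1)
        then show ?thesis using C(2)[of k] \<omega> by (auto simp: A_def)
      qed
      then obtain m where m: "\<And>k. k < K \<Longrightarrow> \<omega> \<in> C k (m k)" by metis
      \<comment> \<open>A time by which the first \<open>K\<close> layers are all in the sum and contain \<open>\<omega>\<close>.\<close>
      define n where "n = K + (\<Sum>k<K. m k)"
      have in_D: "\<omega> \<in> D k n" if "k < K" for k
      proof -
        have "m k \<le> (\<Sum>k<K. m k)" using that by (intro member_le_sum) auto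
        then show ?thesis using m[OF that] unfolding D_def n_def by auto
      qed
      have "real K = (\<Sum>k<K. indicator (D k n) \<omega>)" using in_D by simp
      also have "\<dots> \<le> (\<Sum>k<n. indicator (D k n) \<omega>)"
        by (intro sum_mono2) (auto simp: n_def)
      finally have "d * real K \<le> d * (\<Sum>k<n. indicator (D k n) \<omega>)"
        using d by (intro mult_left_mono) auto
      then have "r \<le> Y n \<omega>"
        unfolding Y_def using K(2) by (subst (asm) mult.commute) linarith
      then show "y \<le> (SUP n. ennreal (Y n \<omega>))"
        unfolding r by (intro SUP_upper2[of n]) (auto intro: ennreal_leI)
    qed
    show "(\<integral>\<^sup>+\<omega>. Y n \<omega> \<partial>P) \<le> (\<integral>\<^sup>+\<omega>. X \<omega> \<partial>P) + ennreal e" for n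
    proof -
      have A_le: "ennreal (d * (\<Sum>k<n. indicator (A k) \<omega>)) \<le> X \<omega>" for \<omega> n
      proof (induction n)
        case (Suc n)
        show ?case
        proof (cases "\<omega> \<in> A n")
          case True
          have "(\<Sum>k<Suc n. indicator (A k) \<omega> :: real) \<le> (\<Sum>k<Suc n. 1)"
            by (intro sum_mono) (auto simp: indicator_def)
          then have "d * (\<Sum>k<Suc n. indicator (A k) \<omega>) \<le> real (Suc n) * d"
            using d by (simp add: mult.commute)
          then have "ennreal (d * (\<Sum>k<Suc n. indicator (A k) \<omega>)) \<le> ennreal (real (Suc n) * d)"
            by (rule ennreal_leI)
          also have "\<dots> \<le> X \<omega>" using True by (auto simp: A_def intro: less_imp_le)
          finally show ?thesis .
        next
          case False
          then show ?thesis using Suc by simp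
        qed
      qed simp
      \<comment> \<open>Bounds the excess of the majorant over the layer cake sum of \<open>X\<close>.\<close>
      define R where "R \<omega> = d + d * (\<Sum>k<n. indicator ((\<Union>m. C k m) - A k) \<omega>)" for \<omega> :: 'a
      have R_nonneg: "0 \<le> R \<omega>" for \<omega>
        unfolding R_def using d by (intro add_nonneg_nonneg mult_nonneg_nonneg sum_nonneg) auto
      have sum_int: "integrable P (\<lambda>\<omega>. \<Sum>k<n. indicator ((\<Union>m. C k m) - A k) \<omega> :: real)"
        by (intro Bochner_Integration.integrable_sum integrable_real_indicator)
          (auto simp: less_top[symmetric])
      have "(\<integral>\<omega>. (\<Sum>k<n. indicator ((\<Union>m. C k m) - A k) \<omega>) \<partial>P)
          = (\<Sum>k<n. prob ((\<Union>m. C k m) - A k))"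
        by (subst Bochner_Integration.integral_sum)
          (auto simp: less_top[symmetric] intro!: integrable_real_indicator)
      note sum_int = sum_int this
      have R_int: "integrable P R"
        unfolding R_def
        by (intro Bochner_Integration.integrable_add integrable_const integrable_mult_right sum_int)
      have "(\<integral>\<omega>. R \<omega> \<partial>P) = d + d * (\<Sum>k<n. prob ((\<Union>m. C k m) - A k))"
        unfolding R_def using sum_int
        by (subst Bochner_Integration.integral_add) (auto simp: prob_space)
      also have "\<dots> \<le> d + d * (\<Sum>k<n. (1/2) ^ Suc k)"
        using C(3) d by (intro add_left_mono mult_left_mono sum_mono) (auto intro: less_imp_le)
      also have "\<dots> \<le> d + d * (\<Sum>k. (1/2) ^ Suc k)"
        using d power_half_series
        by (intro add_left_mono mult_left_mono sum_le_suminf) (auto simp: sums_iff)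
      also have "\<dots> = e" using power_half_series by (simp add: sums_iff d_def)
      finally have R_le: "(\<integral>\<omega>. R \<omega> \<partial>P) \<le> e" .
      have "ennreal (Y n \<omega>) \<le> X \<omega> + ennreal (R \<omega>)" for \<omega>
      proof -
        have "(\<Sum>k<n. indicator (D k n) \<omega> :: real)
          \<le> (\<Sum>k<n. indicator (A k) \<omega> + indicator ((\<Union>m. C k m) - A k) \<omega>)"
          by (intro sum_mono) (auto simp: indicator_def D_def)
        then have "d * (\<Sum>k<n. indicator (D k n) \<omega>)
          \<le> d * (\<Sum>k<n. indicator (A k) \<omega> + indicator ((\<Union>m. C k m) - A k) \<omega>)"
          using d by simp
        then have "Y n \<omega> \<le> d * (\<Sum>k<n. indicator (A k) \<omega>) + R \<omega>"
          unfolding Y_def R_def by (simp add: sum.distrib distrib_left)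
        then have "ennreal (Y n \<omega>) \<le> ennreal (d * (\<Sum>k<n. indicator (A k) \<omega>) + R \<omega>)"
          by (rule ennreal_leI)
        also have "\<dots> = ennreal (d * (\<Sum>k<n. indicator (A k) \<omega>)) + ennreal (R \<omega>)"
          using R_nonneg d by (intro ennreal_plus mult_nonneg_nonneg sum_nonneg) auto
        also have "\<dots> \<le> X \<omega> + ennreal (R \<omega>)" by (intro add_right_mono A_le)
        finally show ?thesis .
      qed
      then have "(\<integral>\<^sup>+\<omega>. Y n \<omega> \<partial>P) \<le> (\<integral>\<^sup>+\<omega>. X \<omega> + ennreal (R \<omega>) \<partial>P)"
        by (intro nn_integral_mono)
      also have "\<dots> = (\<integral>\<^sup>+\<omega>. X \<omega> \<partial>P) + (\<integral>\<^sup>+\<omega>. R \<omega> \<partial>P)"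
        using R_int by (intro nn_integral_add) auto
      also have "(\<integral>\<^sup>+\<omega>. R \<omega> \<partial>P) = ennreal (\<integral>\<omega>. R \<omega> \<partial>P)"
        using R_int R_nonneg by (intro nn_integral_eq_integral) auto
      also have "\<dots> \<le> ennreal e" by (rule ennreal_leI[OF R_le])
      finally show ?thesis by (auto intro: add_left_mono)
    qed
  qed
qed


section \<open>The integral of the upper limit of a test martingale\<close>

lemma set_nn_integral_test_martingale:
  assumes S: "test_martingale P F S" and "m \<le> n" and D: "D \<in> sets (F m)"
  shows "(\<integral>\<^sup>+\<omega>\<in>D. S n \<omega> \<partial>P) = (\<integral>\<^sup>+\<omega>\<in>D. S m \<omega> \<partial>P)"
proof -
  interpret finite_measure_subalgebra P "F m" by (rule finite_measure_subalgebra_F)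
  have int: "integrable P (S k)" for k
    using S by (simp add: test_martingale_def martingale_def)
  have nonneg: "0 \<le> S k \<omega>" if "\<omega> \<in> space P" for k \<omega>
    using S that by (simp add: test_martingale_def)
  have [measurable]: "D \<in> sets P" using D sets_F_subset by blast
  have [measurable]: "S k \<in> borel_measurable P" for k
    using int by auto
  have "AE \<omega> in P. real_cond_exp P (F m) (S n) \<omega> = S m \<omega>"
    using S \<open>m \<le> n\<close> by (simp add: test_martingale_def martingale_def)
  then have "(\<integral>\<omega>\<in>D. real_cond_exp P (F m) (S n) \<omega> \<partial>P) = (\<integral>\<omega>\<in>D. S m \<omega> \<partial>P)"
    unfolding set_lebesgue_integral_def
    using int[of m] by (intro integral_cong_AE) (auto intro: borel_measurable_cond_exp2)
  then have eq: "(\<integral>\<omega>\<in>D. S n \<omega> \<partial>P) = (\<integral>\<omega>\<in>D. S m \<omega> \<partial>P)"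
    using real_cond_exp_intA[OF int D, of n] by simp
  have "(\<integral>\<^sup>+\<omega>\<in>D. S k \<omega> \<partial>P) = ennreal (\<integral>\<omega>\<in>D. S k \<omega> \<partial>P)" for k
  proof -
    have "(\<integral>\<^sup>+\<omega>\<in>D. S k \<omega> \<partial>P) = (\<integral>\<^sup>+\<omega>. ennreal (indicator D \<omega> * S k \<omega>) \<partial>P)"
      by (intro nn_integral_cong) (auto simp: indicator_def)
    also have "\<dots> = ennreal (\<integral>\<omega>. indicator D \<omega> * S k \<omega> \<partial>P)"
      using integrable_mult_indicator[OF \<open>D \<in> sets P\<close> int[of k]] nonneg
      by (intro nn_integral_eq_integral) auto
    finally show ?thesis by (simp add: set_lebesgue_integral_def)
  qed
  then show ?thesis using eq by simp
qed

text \<open>The martingale stopped when it first reaches \<open>W\<close> keeps its integral over \<open>G\<close>, and it is at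
  least \<open>W\<close> on the event that the level is reached. The induction on the length of the time window
  replaces stopping times: the part of \<open>G\<close> where \<open>W\<close> is reached at time \<open>n\<close> is settled, and on
  the rest, which belongs to \<open>F n\<close>, the integrals of \<open>S n\<close> and \<open>S (Suc n)\<close> agree.\<close>

lemma test_martingale_maximal_finite:
  assumes S: "test_martingale P F S"
    and W: "W \<in> borel_measurable (F m)" and "m \<le> n" and "G \<in> sets (F n)"
  shows "(\<integral>\<^sup>+\<omega>\<in>{\<omega>\<in>G. \<exists>i\<in>{n..n + k}. W \<omega> \<le> S i \<omega>}. ennreal (W \<omega>) \<partial>P) \<le> (\<integral>\<^sup>+\<omega>\<in>G. S n \<omega> \<partial>P)"
  using assms(3,4)
proof (induction k arbitrary: n G)
  case 0
  show ?case
    by (intro nn_integral_mono) (auto simp: indicator_def intro: ennreal_leI)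
next
  case (Suc k)
  have S_F[measurable]: "S i \<in> borel_measurable (F i)" for i
    using S by (simp add: test_martingale_def martingale_def)
  have [measurable]: "S i \<in> borel_measurable P" for i
    by (rule measurable_F_imp_measurable[OF S_F])
  have [measurable]: "W \<in> borel_measurable P" by (rule measurable_F_imp_measurable[OF W])
  have WF[measurable]: "W \<in> borel_measurable (F n)" by (rule measurable_F_mono[OF \<open>m \<le> n\<close> W])
  define G1 where "G1 = {\<omega>\<in>G. W \<omega> \<le> S n \<omega>}"
  define G2 where "G2 = {\<omega>\<in>G. \<not> W \<omega> \<le> S n \<omega>}"
  have G12: "G1 \<in> sets (F n)" "G2 \<in> sets (F n)"
    unfolding G1_def G2_def using Suc.prems(2) by measurable
  then have [measurable]: "G1 \<in> sets P" "G2 \<in> sets P" using sets_F_subset by blast+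
  let ?H = "{\<omega>\<in>G2. \<exists>i\<in>{Suc n..Suc n + k}. W \<omega> \<le> S i \<omega>}"
  have step: "(\<exists>i\<in>{n..n + Suc k}. Q i) \<longleftrightarrow> Q n \<or> (\<exists>i\<in>{Suc n..Suc n + k}. Q i)" for Q
  proof -
    have "{n..n + Suc k} = insert n {Suc n..Suc n + k}" by auto
    then show ?thesis by simp
  qed
  have "(\<integral>\<^sup>+\<omega>\<in>{\<omega>\<in>G. \<exists>i\<in>{n..n + Suc k}. W \<omega> \<le> S i \<omega>}. ennreal (W \<omega>) \<partial>P)
    = (\<integral>\<^sup>+\<omega>. ennreal (W \<omega>) * indicator G1 \<omega> + ennreal (W \<omega>) * indicator ?H \<omega> \<partial>P)"
    unfolding step by (intro nn_integral_cong) (auto simp: indicator_def G1_def G2_def)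
  also have "\<dots> = (\<integral>\<^sup>+\<omega>\<in>G1. ennreal (W \<omega>) \<partial>P) + (\<integral>\<^sup>+\<omega>\<in>?H. ennreal (W \<omega>) \<partial>P)"
    by (intro nn_integral_add) measurable
  also have "\<dots> \<le> (\<integral>\<^sup>+\<omega>\<in>G1. S n \<omega> \<partial>P) + (\<integral>\<^sup>+\<omega>\<in>G2. S (Suc n) \<omega> \<partial>P)"
  proof (rule add_mono)
    show "(\<integral>\<^sup>+\<omega>\<in>G1. ennreal (W \<omega>) \<partial>P) \<le> (\<integral>\<^sup>+\<omega>\<in>G1. S n \<omega> \<partial>P)"
      by (intro nn_integral_mono) (auto simp: indicator_def G1_def intro: ennreal_leI)
    show "(\<integral>\<^sup>+\<omega>\<in>?H. ennreal (W \<omega>) \<partial>P) \<le> (\<integral>\<^sup>+\<omega>\<in>G2. S (Suc n) \<omega> \<partial>P)"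
      using Suc.prems(1) by (intro Suc.IH in_sets_F_mono[OF G12(2)]) auto
  qed
  also have "(\<integral>\<^sup>+\<omega>\<in>G2. S (Suc n) \<omega> \<partial>P) = (\<integral>\<^sup>+\<omega>\<in>G2. S n \<omega> \<partial>P)"
    by (rule set_nn_integral_test_martingale[OF S _ G12(2)]) simp
  also have "(\<integral>\<^sup>+\<omega>\<in>G1. S n \<omega> \<partial>P) + \<dots> = (\<integral>\<^sup>+\<omega>\<in>G. S n \<omega> \<partial>P)"
    by (subst nn_integral_add[symmetric], measurable)
      (auto intro!: nn_integral_cong simp: indicator_def G1_def G2_def)
  finally show ?case .
qed

lemma test_martingale_maximal:
  assumes S: "test_martingale P F S" and W: "W \<in> borel_measurable (F m)"
  shows "(\<integral>\<^sup>+\<omega>\<in>{\<omega>\<in>space P. \<exists>i\<ge>m. W \<omega> \<le> S i \<omega>}. ennreal (W \<omega>) \<partial>P) \<le> 1"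
proof -
  have S_F[measurable]: "S i \<in> borel_measurable (F i)" for i
    using S by (simp add: test_martingale_def martingale_def)
  have [measurable]: "S i \<in> borel_measurable P" for i
    by (rule measurable_F_imp_measurable[OF S_F])
  have [measurable]: "W \<in> borel_measurable P" by (rule measurable_F_imp_measurable[OF W])
  define H where "H k = {\<omega>\<in>space P. \<exists>i\<in>{m..m + k}. W \<omega> \<le> S i \<omega>}" for k
  have [measurable]: "H k \<in> sets P" for k unfolding H_def by measurable
  have top_F: "space P \<in> sets (F n)" for n using sets.top[of "F n"] by (simp add: space_F)
  have "(\<integral>\<^sup>+\<omega>\<in>space P. S m \<omega> \<partial>P) = (\<integral>\<^sup>+\<omega>\<in>space P. S 0 \<omega> \<partial>P)"
    by (rule set_nn_integral_test_martingale[OF S _ top_F]) simp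
  also have "\<dots> = (\<integral>\<^sup>+\<omega>. 1 \<partial>P)"
    using S by (intro nn_integral_cong) (simp add: test_martingale_def)
  also have "\<dots> = 1" by (simp add: emeasure_space_1)
  finally have one: "(\<integral>\<^sup>+\<omega>\<in>space P. S m \<omega> \<partial>P) = 1" .
  have H_UN: "{\<omega>\<in>space P. \<exists>i\<ge>m. W \<omega> \<le> S i \<omega>} = (\<Union>k. H k)"
    unfolding H_def by (auto, metis atLeastAtMost_iff le_iff_add order_refl)
  have "(\<integral>\<^sup>+\<omega>\<in>(\<Union>k. H k). ennreal (W \<omega>) \<partial>P) = (\<integral>\<^sup>+\<omega>. (SUP k. ennreal (W \<omega>) * indicator (H k) \<omega>) \<partial>P)"
  proof (intro nn_integral_cong antisym)
    fix \<omega>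
    show "ennreal (W \<omega>) * indicator (\<Union>k. H k) \<omega> \<le> (SUP k. ennreal (W \<omega>) * indicator (H k) \<omega>)"
    proof (cases "\<omega> \<in> (\<Union>k. H k)")
      case True
      then obtain k where "\<omega> \<in> H k" by blast
      then show ?thesis by (intro SUP_upper2[of k]) (auto simp: indicator_def)
    qed simp
  qed (auto intro!: SUP_least mult_left_mono simp: indicator_def)
  also have "\<dots> = (SUP k. \<integral>\<^sup>+\<omega>\<in>H k. ennreal (W \<omega>) \<partial>P)"
    by (intro nn_integral_monotone_convergence_SUP)
      (auto simp: incseq_def le_fun_def H_def indicator_def)
  also have "\<dots> \<le> 1"
  proof (rule SUP_least)
    fix k show "(\<integral>\<^sup>+\<omega>\<in>H k. ennreal (W \<omega>) \<partial>P) \<le> 1"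
      using test_martingale_maximal_finite[OF S W order_refl top_F, of k] one by (simp add: H_def)
  qed
  finally show ?thesis using H_UN by simp
qed


text \<open>It suffices to bound the integral of the truncation \<open>XK\<close> of \<open>X\<close> at each level \<open>K\<close>. Let
  \<open>Y\<close> be an increasing adapted majorant of \<open>XK\<close> with integral exceeding that of \<open>XK\<close> by at most
  \<open>\<delta>\<close>. The maximal inequality applies to \<open>W = max 0 (min K (Y n) - \<eta>)\<close>. If \<open>S\<close> never
  reaches \<open>W\<close> from time \<open>n\<close> on, then \<open>X \<le> W\<close>, so the majorant exceeds \<open>XK\<close> by \<open>\<eta>\<close> at least;
  by Markov's inequality this exceptional event \<open>B\<close> has probability at most \<open>\<delta> / \<eta>\<close>. Hence
  \<open>min K (Y n)\<close> has integral at most \<open>1 + \<eta> + K * \<delta> / \<eta>\<close>, and \<open>n\<close> tends to infinity.\<close>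

lemma nn_integral_limsup_test_martingale:
  assumes S: "test_martingale P F S"
  defines "X \<equiv> \<lambda>\<omega>. e2ennreal (limsup (\<lambda>n. ereal (S n \<omega>)))"
  shows "X \<in> borel_measurable (sigma (space P) (\<Union>n. sets (F n)))"
    and "(\<integral>\<^sup>+\<omega>. X \<omega> \<partial>P) \<le> 1"
proof -
  let ?Finf = "sigma (space P) (\<Union>n. sets (F n))"
  have S_F: "S i \<in> borel_measurable (F i)" for i
    using S by (simp add: test_martingale_def martingale_def)
  have [measurable]: "S i \<in> borel_measurable P" for i
    by (rule measurable_F_imp_measurable[OF S_F])
  have S_nonneg: "0 \<le> S n \<omega>" if "\<omega> \<in> space P" for n \<omega>
    using S that by (simp add: test_martingale_def)
  have gen: "(\<Union>n. sets (F n)) \<subseteq> Pow (space P)"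
    using sets_F_subset sets.sets_into_space by blast
  have S_Finf[measurable]: "S i \<in> borel_measurable ?Finf" for i
  proof (rule measurable_from_subalg[OF _ S_F])
    show "subalgebra ?Finf (F i)"
      using gen by (auto simp: subalgebra_def space_F sets_measure_of space_measure_of)
  qed
  show X_Finf[measurable]: "X \<in> borel_measurable ?Finf"
    unfolding X_def by measurable
  have XP[measurable]: "X \<in> borel_measurable P"
    unfolding X_def by measurable
  have trunc: "(\<integral>\<^sup>+\<omega>. min (X \<omega>) (ennreal K) \<partial>P) \<le> 1" if "0 < K" for K :: real
  proof (rule ennreal_le_epsilon)
    fix e :: real assume "0 < e"
    define \<eta> where "\<eta> = e / 2"
    have \<eta>: "0 < \<eta>" using \<open>0 < e\<close> by (simp add: \<eta>_def)
    \<comment> \<open>This choice makes the contribution \<open>K * \<delta> / \<eta>\<close> of the exceptional event equal to \<open>\<eta>\<close>.\<close>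
    define \<delta> where "\<delta> = \<eta> * \<eta> / K"
    have \<delta>: "0 < \<delta>" using \<eta> \<open>0 < K\<close> by (simp add: \<delta>_def)
    define XK where "XK \<omega> = min (X \<omega>) (ennreal K)" for \<omega>
    have [measurable]: "XK \<in> borel_measurable ?Finf" "XK \<in> borel_measurable P"
      unfolding XK_def by measurable
    obtain Y :: "nat \<Rightarrow> 'a \<Rightarrow> real" where
      Y_F: "\<And>n. Y n \<in> borel_measurable (F n)" and
      Y_pos: "\<And>n \<omega>. 0 < Y n \<omega>" and
      Y_inc: "\<And>\<omega>. incseq (\<lambda>n. Y n \<omega>)" and
      Y_ge: "\<And>\<omega>. \<omega> \<in> space P \<Longrightarrow> XK \<omega> \<le> (SUP n. ennreal (Y n \<omega>))" and
      Y_int: "\<And>n. (\<integral>\<^sup>+\<omega>. Y n \<omega> \<partial>P) \<le> (\<integral>\<^sup>+\<omega>. XK \<omega> \<partial>P) + ennreal \<delta>"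
      using increasing_adapted_majorant[OF \<open>XK \<in> borel_measurable ?Finf\<close> \<delta>] by blast
    have [measurable]: "Y n \<in> borel_measurable P" for n
      by (rule measurable_F_imp_measurable[OF Y_F])
    define Ysup where "Ysup \<omega> = (SUP n. ennreal (Y n \<omega>))" for \<omega>
    have [measurable]: "Ysup \<in> borel_measurable P" unfolding Ysup_def by measurable
    define B where "B = {\<omega>\<in>space P. XK \<omega> + ennreal \<eta> \<le> Ysup \<omega>}"
    have [measurable]: "B \<in> sets P" unfolding B_def by measurable
    have XK_finite: "(\<integral>\<^sup>+\<omega>. XK \<omega> \<partial>P) \<noteq> \<top>"
    proof -
      have "(\<integral>\<^sup>+\<omega>. XK \<omega> \<partial>P) \<le> (\<integral>\<^sup>+\<omega>. ennreal K \<partial>P)"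
        by (intro nn_integral_mono) (simp add: XK_def)
      also have "\<dots> = ennreal K" by (simp add: emeasure_space_1)
      finally show ?thesis by (auto simp: top_unique)
    qed
    \<comment> \<open>Markov's inequality for \<open>Ysup - XK\<close>, stated without subtraction.\<close>
    have "(\<integral>\<^sup>+\<omega>. XK \<omega> \<partial>P) + ennreal \<eta> * emeasure P B
        = (\<integral>\<^sup>+\<omega>. XK \<omega> + ennreal \<eta> * indicator B \<omega> \<partial>P)"
      by (simp add: nn_integral_add nn_integral_cmult_indicator)
    also have "\<dots> \<le> (\<integral>\<^sup>+\<omega>. Ysup \<omega> \<partial>P)"
      using Y_ge by (intro nn_integral_mono) (auto simp: indicator_def B_def Ysup_def)
    also have "\<dots> = (SUP n. \<integral>\<^sup>+\<omega>. Y n \<omega> \<partial>P)"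
      unfolding Ysup_def using Y_inc
      by (intro nn_integral_monotone_convergence_SUP) (auto simp: incseq_def le_fun_def intro: ennreal_leI)
    also have "\<dots> \<le> (\<integral>\<^sup>+\<omega>. XK \<omega> \<partial>P) + ennreal \<delta>"
      by (intro SUP_least Y_int)
    finally have "ennreal \<eta> * emeasure P B \<le> ennreal \<delta>"
      using XK_finite by (simp add: ennreal_add_left_cancel_le)
    then have "\<eta> * prob B \<le> \<delta>"
      using \<eta> \<delta> by (simp add: emeasure_eq_measure flip: ennreal_mult)
    then have "K * (\<eta> * prob B) \<le> K * \<delta>"
      using \<open>0 < K\<close> by simp
    then have "\<eta> * (K * prob B) \<le> \<eta> * \<eta>"
      using \<open>0 < K\<close> by (simp add: \<delta>_def mult_ac)
    then have KB: "K * prob B \<le> \<eta>"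
      using \<eta> by simp
    define V where "V n \<omega> = min K (Y n \<omega>)" for n \<omega>
    have V_int: "(\<integral>\<^sup>+\<omega>. V n \<omega> \<partial>P) \<le> 1 + ennreal e" for n
    proof -
      define W where "W \<omega> = max 0 (V n \<omega> - \<eta>)" for \<omega>
      have W_F: "W \<in> borel_measurable (F n)"
        unfolding W_def V_def using Y_F by measurable
      have [measurable]: "W \<in> borel_measurable P"
        by (rule measurable_F_imp_measurable[OF W_F])
      define H where "H = {\<omega>\<in>space P. \<exists>i\<ge>n. W \<omega> \<le> S i \<omega>}"
      have [measurable]: "H \<in> sets P" unfolding H_def by measurable
      have "ennreal (V n \<omega>) \<le> ennreal (W \<omega>) * indicator H \<omega> + (ennreal \<eta> + ennreal K * indicator B \<omega>)"
        if \<omega>: "\<omega> \<in> space P" for \<omega>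
      proof (cases "\<omega> \<in> H")
        case True
        have "V n \<omega> \<le> W \<omega> + \<eta>" by (simp add: W_def)
        then have "ennreal (V n \<omega>) \<le> ennreal (W \<omega> + \<eta>)" by (rule ennreal_leI)
        also have "\<dots> = ennreal (W \<omega>) + ennreal \<eta>"
          using \<eta> by (intro ennreal_plus) (auto simp: W_def)
        also have "\<dots> \<le> ennreal (W \<omega>) * indicator H \<omega> + (ennreal \<eta> + ennreal K * indicator B \<omega>)"
          using True by (auto simp: add.assoc intro!: add_left_mono)
        finally show ?thesis .
      next
        case False
        then have less: "S i \<omega> < W \<omega>" if "n \<le> i" for i
        proof -
          have "\<not> W \<omega> \<le> S i \<omega>" using False \<omega> that by (auto simp: H_def)
          then show ?thesis by simp
        qed
        have W_pos: "0 < W \<omega>"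
          using less[of n] S_nonneg[OF \<omega>, of n] by simp
        have "limsup (\<lambda>i. ereal (S i \<omega>)) \<le> ereal (W \<omega>)"
          using less by (intro Limsup_bounded) (auto simp: eventually_sequentially intro: less_imp_le)
        then have "X \<omega> \<le> ennreal (W \<omega>)"
          unfolding X_def using e2ennreal_mono by fastforce
        then have "XK \<omega> + ennreal \<eta> \<le> ennreal (W \<omega>) + ennreal \<eta>"
          by (intro add_right_mono) (auto simp: XK_def min_le_iff_disj)
        also have "\<dots> = ennreal (W \<omega> + \<eta>)"
          using \<eta> W_pos by (intro ennreal_plus[symmetric]) auto
        also have "\<dots> \<le> ennreal (Y n \<omega>)"
          using W_pos by (intro ennreal_leI) (auto simp: W_def V_def)
        also have "\<dots> \<le> Ysup \<omega>"
          unfolding Ysup_def by (intro SUP_upper) auto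
        finally have "\<omega> \<in> B" using \<omega> by (simp add: B_def)
        then have "ennreal (V n \<omega>) \<le> ennreal K * indicator B \<omega>"
          by (auto simp: V_def intro!: ennreal_leI)
        also have "\<dots> \<le> ennreal (W \<omega>) * indicator H \<omega> + (ennreal \<eta> + ennreal K * indicator B \<omega>)"
          by (simp add: add_increasing)
        finally show ?thesis .
      qed
      then have "(\<integral>\<^sup>+\<omega>. V n \<omega> \<partial>P) \<le>
        (\<integral>\<^sup>+\<omega>. ennreal (W \<omega>) * indicator H \<omega> + (ennreal \<eta> + ennreal K * indicator B \<omega>) \<partial>P)"
        by (intro nn_integral_mono) auto
      also have "\<dots> = (\<integral>\<^sup>+\<omega>\<in>H. ennreal (W \<omega>) \<partial>P) + (ennreal \<eta> + ennreal K * emeasure P B)"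
        by (simp add: nn_integral_add nn_integral_cmult_indicator emeasure_space_1)
      also have "\<dots> \<le> 1 + (ennreal \<eta> + ennreal K * emeasure P B)"
        unfolding H_def by (intro add_right_mono test_martingale_maximal[OF S W_F])
      also have "ennreal K * emeasure P B = ennreal (K * prob B)"
        using \<open>0 < K\<close> by (simp add: emeasure_eq_measure ennreal_mult)
      also have "ennreal \<eta> + ennreal (K * prob B) = ennreal (\<eta> + K * prob B)"
        using \<open>0 < K\<close> \<eta> by (intro ennreal_plus[symmetric]) auto
      also have "\<dots> \<le> ennreal e"
        using KB by (intro ennreal_leI) (simp add: \<eta>_def)
      finally show ?thesis by (auto intro: add_left_mono)
    qed
    have [measurable]: "V n \<in> borel_measurable P" for n unfolding V_def by measurable
    have "XK \<omega> \<le> (SUP n. ennreal (V n \<omega>))" if \<omega>: "\<omega> \<in> space P" for \<omega>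
    proof (rule dense_le)
      fix y assume y: "y < XK \<omega>"
      then obtain n where "y < ennreal (Y n \<omega>)"
        using Y_ge[OF \<omega>] by (meson less_SUP_iff order.strict_trans2)
      moreover have "y < ennreal K" using y by (simp add: XK_def)
      ultimately have "y < ennreal (V n \<omega>)" by (auto simp: V_def min_def)
      then show "y \<le> (SUP n. ennreal (V n \<omega>))"
        by (intro SUP_upper2[of n]) auto
    qed
    then have "(\<integral>\<^sup>+\<omega>. XK \<omega> \<partial>P) \<le> (\<integral>\<^sup>+\<omega>. (SUP n. ennreal (V n \<omega>)) \<partial>P)"
      by (intro nn_integral_mono) auto
    also have "\<dots> = (SUP n. \<integral>\<^sup>+\<omega>. V n \<omega> \<partial>P)"
      using Y_inc by (intro nn_integral_monotone_convergence_SUP)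
        (auto simp: incseq_def le_fun_def V_def min_le_iff_disj intro!: ennreal_leI)
    also have "\<dots> \<le> 1 + ennreal e"
      by (intro SUP_least V_int)
    finally show "(\<integral>\<^sup>+\<omega>. min (X \<omega>) (ennreal K) \<partial>P) \<le> 1 + ennreal e"
      by (simp add: XK_def)
  qed
  have "X \<omega> \<le> (SUP k. min (X \<omega>) (ennreal (real (Suc k))))" for \<omega>
  proof (rule dense_le)
    fix y assume y: "y < X \<omega>"
    then obtain r where r: "y = ennreal r" "0 \<le> r"
      by (cases y) (auto simp: top_unique)
    obtain k where "r \<le> real k" using real_arch_simple by blast
    then have "y \<le> ennreal (real (Suc k))" unfolding r by (intro ennreal_leI) simp
    then show "y \<le> (SUP k. min (X \<omega>) (ennreal (real (Suc k))))"
      using y by (intro SUP_upper2[of k]) auto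
  qed
  then have "(\<integral>\<^sup>+\<omega>. X \<omega> \<partial>P) \<le> (\<integral>\<^sup>+\<omega>. (SUP k. min (X \<omega>) (ennreal (real (Suc k)))) \<partial>P)"
    by (intro nn_integral_mono) auto
  also have "\<dots> = (SUP k. \<integral>\<^sup>+\<omega>. min (X \<omega>) (ennreal (real (Suc k))) \<partial>P)"
    by (intro nn_integral_monotone_convergence_SUP)
      (auto simp del: of_nat_Suc simp: incseq_def le_fun_def intro!: min.coboundedI2 ennreal_leI)
  also have "\<dots> \<le> 1" by (intro SUP_least trunc) simp
  finally show "(\<integral>\<^sup>+\<omega>. X \<omega> \<partial>P) \<le> 1" .
qed

section \<open>A test martingale above an increasing adapted sequence\<close>

lemma measurable_trivial_const:
  fixes f :: "'a \<Rightarrow> real"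
  assumes "sets (F 0) \<subseteq> {{}, space P}" and f: "f \<in> borel_measurable (F 0)"
    and "\<omega> \<in> space P" "\<omega>' \<in> space P"
  shows "f \<omega>' = f \<omega>"
proof -
  have "{x \<in> space (F 0). f x = f \<omega>} \<in> sets (F 0)" using f by measurable
  then have "{x \<in> space P. f x = f \<omega>} = space P" using assms by (auto simp: space_F)
  then show ?thesis using \<open>\<omega>' \<in> space P\<close> by blast
qed

text \<open>The conditional expectations of the limit of \<open>Y\<close> form a martingale that is almost surely above
  \<open>Y\<close>. Taking the maximum with \<open>Y n\<close> changes the version of the conditional expectation so that
  this holds everywhere, which matters because the result is used on null sets of \<open>P\<close>. Triviality
  of \<open>F 0\<close> makes the initial value a constant, so that division normalises it to 1 at every
  point.\<close>

lemma test_martingale_above_increasing: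
  fixes Y :: "nat \<Rightarrow> 'a \<Rightarrow> real"
  assumes F0: "sets (F 0) \<subseteq> {{}, space P}"
    and Y_F: "\<And>n. Y n \<in> borel_measurable (F n)"
    and Y_pos: "\<And>n \<omega>. 0 < Y n \<omega>"
    and Y_inc: "\<And>\<omega>. incseq (\<lambda>n. Y n \<omega>)"
    and Y_int: "\<And>n. (\<integral>\<^sup>+\<omega>. Y n \<omega> \<partial>P) \<le> ennreal c" and "0 \<le> c"
  obtains S where "test_martingale P F S" "\<And>n \<omega>. \<omega> \<in> space P \<Longrightarrow> Y n \<omega> \<le> c * S n \<omega>"
proof -
  have [measurable]: "Y n \<in> borel_measurable P" for n
    by (rule measurable_F_imp_measurable[OF Y_F])
  define Ysup where "Ysup \<omega> = (SUP n. ennreal (Y n \<omega>))" for \<omega>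
  have [measurable]: "Ysup \<in> borel_measurable P" unfolding Ysup_def by measurable
  have Y_le_sup: "ennreal (Y n \<omega>) \<le> Ysup \<omega>" for n \<omega>
    unfolding Ysup_def by (intro SUP_upper) auto
  have "(\<integral>\<^sup>+\<omega>. Ysup \<omega> \<partial>P) = (SUP n. \<integral>\<^sup>+\<omega>. Y n \<omega> \<partial>P)"
    unfolding Ysup_def using Y_inc
    by (intro nn_integral_monotone_convergence_SUP) (auto simp: incseq_def le_fun_def intro: ennreal_leI)
  then have Ysup_int: "(\<integral>\<^sup>+\<omega>. Ysup \<omega> \<partial>P) \<le> ennreal c"
    using Y_int by (auto intro: SUP_least)
  then have "(\<integral>\<^sup>+\<omega>. Ysup \<omega> \<partial>P) \<noteq> \<infinity>" by (auto simp: top_unique)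
  then have fin: "AE \<omega> in P. Ysup \<omega> \<noteq> \<infinity>"
    by (intro nn_integral_PInf_AE) auto
  \<comment> \<open>A real version of the limit: \<open>enn2real\<close> sends \<open>\<infinity>\<close> to 0, on a null set only.\<close>
  define y where "y \<omega> = enn2real (Ysup \<omega>)" for \<omega>
  have [measurable]: "y \<in> borel_measurable P" unfolding y_def by measurable
  have y_eq: "AE \<omega> in P. ennreal (y \<omega>) = Ysup \<omega>"
    using fin by eventually_elim (simp add: y_def less_top)
  have y_int_eq: "(\<integral>\<^sup>+\<omega>. y \<omega> \<partial>P) = (\<integral>\<^sup>+\<omega>. Ysup \<omega> \<partial>P)"
    by (rule nn_integral_cong_AE[OF y_eq])
  have "(\<integral>\<^sup>+\<omega>. y \<omega> \<partial>P) < \<infinity>"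
    unfolding y_int_eq using Ysup_int by (rule order.strict_trans1) simp
  then have y_int: "integrable P y"
    by (intro integrableI_nonneg) (auto simp: y_def)
  have Y_le: "AE \<omega> in P. Y n \<omega> \<le> y \<omega>" for n
    using y_eq
  proof eventually_elim
    case (elim \<omega>)
    then have "ennreal (Y n \<omega>) \<le> ennreal (y \<omega>)"
      using Y_le_sup[of n \<omega>] by metis
    then show ?case
      by (subst (asm) ennreal_le_iff) (simp_all add: y_def)
  qed
  have Y_integrable: "integrable P (Y n)" for n
  proof (rule integrableI_nonneg)
    show "(\<integral>\<^sup>+\<omega>. Y n \<omega> \<partial>P) < \<infinity>"
      using Y_int[of n] by (rule order.strict_trans1) simp
  qed (use Y_pos in \<open>auto intro: less_imp_le\<close>)
  define a where "a = (\<integral>\<omega>. y \<omega> \<partial>P)"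
  have "ennreal a \<le> ennreal c"
    unfolding a_def using Ysup_int y_int_eq y_int
    by (subst nn_integral_eq_integral[symmetric]) (auto simp: y_def)
  then have "a \<le> c" using \<open>0 \<le> c\<close> by simp
  have "0 < a"
  proof -
    have "0 \<le> a" unfolding a_def by (intro Bochner_Integration.integral_nonneg) (simp add: y_def)
    moreover have "a \<noteq> 0"
    proof
      have y_nonneg: "AE \<omega> in P. 0 \<le> y \<omega>" by (simp add: y_def)
      assume "a = 0"
      then have "AE \<omega> in P. y \<omega> = 0"
        using integral_nonneg_eq_0_iff_AE[OF y_int] y_nonneg by (simp add: a_def)
      then have "AE \<omega> in P. False"
        using Y_le[of 0] by eventually_elim (metis Y_pos not_le)
      then show False by simp
    qed
    ultimately show ?thesis by simp
  qed
  define E where "E n = real_cond_exp P (F n) y" for n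
  have E_F: "E n \<in> borel_measurable (F n)" for n
    unfolding E_def by (rule borel_measurable_cond_exp)
  have [measurable]: "E n \<in> borel_measurable P" for n
    by (rule measurable_F_imp_measurable[OF E_F])
  define S where "S n \<omega> = max (Y n \<omega>) (E n \<omega>) / a" for n \<omega>
  have S_F: "S n \<in> borel_measurable (F n)" for n
    unfolding S_def using E_F[of n] Y_F[of n] by measurable
  have [measurable]: "S n \<in> borel_measurable P" for n
    by (rule measurable_F_imp_measurable[OF S_F])
  have S_pos: "0 < S n \<omega>" for n \<omega>
    unfolding S_def using Y_pos[of n \<omega>] \<open>0 < a\<close> by simp
  have E_int: "integrable P (E n)" "(\<integral>\<omega>. E n \<omega> \<partial>P) = a" for n
  proof -
    interpret finite_measure_subalgebra P "F n" by (rule finite_measure_subalgebra_F)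
    show "integrable P (E n)" "(\<integral>\<omega>. E n \<omega> \<partial>P) = a"
      unfolding E_def a_def using real_cond_exp_int[OF y_int] by auto
  qed
  have S_eq: "AE \<omega> in P. S n \<omega> = E n \<omega> / a" for n
  proof -
    interpret finite_measure_subalgebra P "F n" by (rule finite_measure_subalgebra_F)
    have "AE \<omega> in P. real_cond_exp P (F n) (Y n) \<omega> \<le> E n \<omega>"
      unfolding E_def by (rule real_cond_exp_mono[OF Y_le Y_integrable y_int])
    moreover have "AE \<omega> in P. real_cond_exp P (F n) (Y n) \<omega> = Y n \<omega>"
      by (rule real_cond_exp_F_meas[OF Y_integrable Y_F])
    ultimately show ?thesis
      by eventually_elim (simp add: S_def)
  qed
  have S_int: "integrable P (S n)" for n
  proof -
    have "integrable P (\<lambda>\<omega>. E n \<omega> / a)" using E_int by auto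
    then show ?thesis using S_eq[of n] by (subst integrable_cong_AE) auto
  qed
  have "martingale P F S"
    unfolding martingale_def
  proof (intro conjI allI impI)
    show "filtration (space P) F" by (rule filtration_axioms)
    fix m n :: nat assume "m \<le> n"
    interpret finite_measure_subalgebra P "F m" by (rule finite_measure_subalgebra_F)
    have "AE \<omega> in P. real_cond_exp P (F m) (S n) \<omega> = real_cond_exp P (F m) (\<lambda>\<omega>. E n \<omega> / a) \<omega>"
      by (rule real_cond_exp_cong[OF S_eq]) auto
    moreover have "AE \<omega> in P. real_cond_exp P (F m) (\<lambda>\<omega>. E n \<omega> / a) \<omega> = real_cond_exp P (F m) (E n) \<omega> / a"
      by (rule real_cond_exp_cdiv[OF E_int(1)])
    moreover have "AE \<omega> in P. real_cond_exp P (F m) (E n) \<omega> = E m \<omega>"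
      unfolding E_def
      by (rule real_cond_exp_nested_subalg[OF subalgebra_F _ y_int])
        (simp add: subalgebra_def space_F sets_F_mono \<open>m \<le> n\<close>)
    ultimately show "AE \<omega> in P. real_cond_exp P (F m) (S n) \<omega> = S m \<omega>"
      using S_eq[of m] by eventually_elim simp
  qed (auto intro: subalgebra_F S_F S_int)
  moreover have "S 0 \<omega> = 1" if "\<omega> \<in> space P" for \<omega>
  proof -
    have "(\<integral>\<omega>'. S 0 \<omega>' \<partial>P) = (\<integral>\<omega>'. S 0 \<omega> \<partial>P)"
      by (intro Bochner_Integration.integral_cong refl measurable_trivial_const[OF F0 S_F that])
    moreover have "(\<integral>\<omega>'. S 0 \<omega>' \<partial>P) = (\<integral>\<omega>'. E 0 \<omega>' / a \<partial>P)"
      by (rule integral_cong_AE[OF _ _ S_eq]) auto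
    ultimately show ?thesis
      using E_int(2)[of 0] \<open>0 < a\<close> by (simp add: prob_space)
  qed
  ultimately have "test_martingale P F S"
    using S_pos by (auto simp: test_martingale_def intro: less_imp_le)
  moreover have "Y n \<omega> \<le> c * S n \<omega>" if "\<omega> \<in> space P" for n \<omega>
  proof -
    have "Y n \<omega> \<le> a * S n \<omega>" using \<open>0 < a\<close> by (simp add: S_def)
    also have "\<dots> \<le> c * S n \<omega>"
      using \<open>a \<le> c\<close> S_pos[of n \<omega>] by (intro mult_right_mono) auto
    finally show ?thesis .
  qed
  ultimately show thesis by (rule that)
qed

end

section \<open>Passing to a finer filtration\<close>

lemma test_martingale_filtered_prob_space:
  assumes "prob_space P" and "test_martingale P F S"
  shows "filtered_prob_space P F"
  using assms
  by (simp add: filtered_prob_space_def filtered_prob_space_axioms_def test_martingale_def martingale_def)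

text \<open>The majorant of the upper limit is adapted to \<open>F\<close>, hence to the finer filtration \<open>G\<close>, and
  only the martingale built above it has to be formed with respect to \<open>G\<close>. The conclusion is
  pointwise, so it survives a change of the measure.\<close>

lemma test_martingale_refine_filtration:
  fixes P :: "'a measure" and F G :: "nat \<Rightarrow> 'a measure" and S :: "nat \<Rightarrow> 'a \<Rightarrow> real"
  assumes S: "test_martingale P F S"
    and G: "filtered_prob_space P G"
    and sub: "\<And>n. sets (F n) \<subseteq> sets (G n)"
    and G0: "sets (G 0) \<subseteq> {{}, space P}"
    and "0 < e"
  obtains S' where "test_martingale P G S'"
    and "\<And>\<omega>. \<omega> \<in> space P \<Longrightarrow>
      limsup (\<lambda>n. ereal (S n \<omega>)) \<le> ereal (1 + e) * liminf (\<lambda>n. ereal (S' n \<omega>))"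
proof -
  interpret G: filtered_prob_space P G by (rule G)
  interpret F: filtered_prob_space P F
    by (rule test_martingale_filtered_prob_space[OF G.prob_space_axioms S])
  define X where "X \<omega> = e2ennreal (limsup (\<lambda>n. ereal (S n \<omega>)))" for \<omega>
  have X: "X \<in> borel_measurable (sigma (space P) (\<Union>n. sets (F n)))" "(\<integral>\<^sup>+\<omega>. X \<omega> \<partial>P) \<le> 1"
    unfolding X_def by (rule F.nn_integral_limsup_test_martingale[OF S])+
  obtain Y :: "nat \<Rightarrow> 'a \<Rightarrow> real" where
    Y_F: "\<And>n. Y n \<in> borel_measurable (F n)" and
    Y_pos: "\<And>n \<omega>. 0 < Y n \<omega>" and
    Y_inc: "\<And>\<omega>. incseq (\<lambda>n. Y n \<omega>)" and
    Y_ge: "\<And>\<omega>. \<omega> \<in> space P \<Longrightarrow> X \<omega> \<le> (SUP n. ennreal (Y n \<omega>))" and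
    Y_int: "\<And>n. (\<integral>\<^sup>+\<omega>. Y n \<omega> \<partial>P) \<le> (\<integral>\<^sup>+\<omega>. X \<omega> \<partial>P) + ennreal e"
    using F.increasing_adapted_majorant[OF X(1) \<open>0 < e\<close>] by blast
  have Y_G: "Y n \<in> borel_measurable (G n)" for n
    by (rule measurable_from_subalg[OF _ Y_F])
      (use sub in \<open>simp add: subalgebra_def F.space_F G.space_F\<close>)
  have Y_int': "(\<integral>\<^sup>+\<omega>. Y n \<omega> \<partial>P) \<le> ennreal (1 + e)" for n
  proof -
    have "(\<integral>\<^sup>+\<omega>. Y n \<omega> \<partial>P) \<le> 1 + ennreal e"
      using Y_int[of n] X(2) by (meson add_right_mono order_trans)
    also have "\<dots> = ennreal (1 + e)" using \<open>0 < e\<close> by simp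
    finally show ?thesis .
  qed
  obtain S' where S': "test_martingale P G S'"
    and above: "\<And>n \<omega>. \<omega> \<in> space P \<Longrightarrow> Y n \<omega> \<le> (1 + e) * S' n \<omega>"
    using G.test_martingale_above_increasing[OF G0 Y_G Y_pos Y_inc Y_int'] \<open>0 < e\<close> by auto
  show thesis
  proof (rule that[OF S'])
    fix \<omega> assume \<omega>: "\<omega> \<in> space P"
    define L where "L = liminf (\<lambda>n. ereal (S' n \<omega>))"
    have Y_L: "ereal (Y n \<omega>) \<le> ereal (1 + e) * L" for n
    proof -
      have "ereal (Y n \<omega> / (1 + e)) \<le> L"
        unfolding L_def
      proof (rule Liminf_bounded)
        show "\<forall>\<^sub>F k in sequentially. ereal (Y n \<omega> / (1 + e)) \<le> ereal (S' k \<omega>)"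
        proof (rule eventually_sequentiallyI[of n])
          fix k assume "n \<le> k"
          then have "Y n \<omega> \<le> (1 + e) * S' k \<omega>"
            using above[OF \<omega>, of k] Y_inc[of \<omega>] by (meson incseqD order_trans)
          then show "ereal (Y n \<omega> / (1 + e)) \<le> ereal (S' k \<omega>)"
            using \<open>0 < e\<close> by (simp add: field_simps)
        qed
      qed
      then have "ereal (1 + e) * ereal (Y n \<omega> / (1 + e)) \<le> ereal (1 + e) * L"
        using \<open>0 < e\<close> by (intro ereal_mult_left_mono) auto
      then show ?thesis using \<open>0 < e\<close> by simp
    qed
    show "limsup (\<lambda>n. ereal (S n \<omega>)) \<le> ereal (1 + e) * L"
    proof (rule dense_le)
      fix z assume z: "z < limsup (\<lambda>n. ereal (S n \<omega>))"
      show "z \<le> ereal (1 + e) * L"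
      proof (cases "0 \<le> z")
        case True
        have "e2ennreal z < X \<omega>"
        proof (rule ccontr)
          assume "\<not> e2ennreal z < X \<omega>"
          then have "enn2ereal (X \<omega>) \<le> enn2ereal (e2ennreal z)"
            by (simp add: less_eq_ennreal.rep_eq[symmetric])
          then show False using z True by (simp add: X_def enn2ereal_e2ennreal)
        qed
        then obtain n where "e2ennreal z < ennreal (Y n \<omega>)"
          using Y_ge[OF \<omega>] by (meson less_SUP_iff order.strict_trans2)
        then have "enn2ereal (e2ennreal z) < enn2ereal (ennreal (Y n \<omega>))"
          by (simp add: less_ennreal.rep_eq)
        then have "z \<le> ereal (Y n \<omega>)"
          using True Y_pos[of n \<omega>] by (simp add: enn2ereal_e2ennreal enn2ereal_ennreal less_imp_le)
        then show ?thesis using Y_L[of n] by (rule order_trans)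
      next
        case False
        then have "z \<le> ereal (Y 0 \<omega>)" using Y_pos[of 0 \<omega>] by (cases z) auto
        then show ?thesis using Y_L[of 0] by (rule order_trans)
      qed
    qed
  qed
qed

section \<open>Finite models and the natural filtration\<close>

lemma le_liminf_INF_finite:
  fixes f :: "'b \<Rightarrow> nat \<Rightarrow> ereal"
  assumes "finite I" and le: "\<And>i. i \<in> I \<Longrightarrow> c \<le> liminf (f i)"
  shows "c \<le> liminf (\<lambda>n. INF i\<in>I. f i n)"
proof (rule dense_le)
  fix y assume "y < c"
  then have "\<forall>i\<in>I. \<forall>\<^sub>F n in sequentially. y < f i n"
    using le by (auto simp: le_Liminf_iff)
  then have "\<forall>\<^sub>F n in sequentially. \<forall>i\<in>I. y < f i n"
    using \<open>finite I\<close> by (simp add: eventually_ball_finite)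
  then have "\<forall>\<^sub>F n in sequentially. y \<le> (INF i\<in>I. f i n)"
    by eventually_elim (intro INF_greatest, simp add: less_imp_le)
  then show "y \<le> liminf (\<lambda>n. INF i\<in>I. f i n)"
    by (rule Liminf_bounded)
qed

lemma filtered_prob_space_natural_filtration:
  assumes "prob_space P" and sets: "sets P = sets M"
    and Z: "\<And>n. 1 \<le> n \<Longrightarrow> Z n \<in> measurable M N"
  shows "filtered_prob_space P (natural_filtration M N Z)"
proof -
  have space: "space P = space M" by (rule sets_eq_imp_space_eq[OF sets])
  let ?gen = "\<lambda>n. {Z i -` A \<inter> space M | i A. i \<in> {1..n} \<and> A \<in> sets N}"
  have gen: "?gen n \<subseteq> Pow (space M)" for n by auto
  have sets_nat: "sets (natural_filtration M N Z n) = sigma_sets (space M) (?gen n)" for n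
    unfolding natural_filtration_def by (rule sets_measure_of[OF gen])
  have space_nat: "space (natural_filtration M N Z n) = space M" for n
    unfolding natural_filtration_def by (rule space_measure_of[OF gen])
  have mono: "sets (natural_filtration M N Z m) \<subseteq> sets (natural_filtration M N Z n)" if "m \<le> n" for m n
    unfolding sets_nat using that by (intro sigma_sets_mono') (auto, fastforce)
  have "sets (natural_filtration M N Z n) \<subseteq> sets M" for n
    unfolding sets_nat using Z by (intro sets.sigma_sets_subset) auto
  then show ?thesis
    using assms(1) mono
    by (simp add: filtered_prob_space_def filtered_prob_space_axioms_def filtration_def
        subalgebra_def space space_nat sets)
qed

lemma natural_filtration_0: "sets (natural_filtration M N Z 0) = {{}, space M}"
  unfolding natural_filtration_def by (simp add: sigma_sets_empty_eq)

theorem proposition6p2: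
  fixes M :: "'a measure" and N :: "'z measure"
    and \<Theta> :: "'t set" and P :: "'t \<Rightarrow> 'a measure"
    and Z :: "nat \<Rightarrow> 'a \<Rightarrow> 'z"
    and F' :: "nat \<Rightarrow> 'a measure"
    and S :: "'t \<Rightarrow> nat \<Rightarrow> 'a \<Rightarrow> real"
    and \<epsilon> :: real
  assumes "finite \<Theta>" and "\<Theta> \<noteq> {}"
    and "\<And>\<theta>. \<theta> \<in> \<Theta> \<Longrightarrow> prob_space (P \<theta>)"
    and "\<And>\<theta>. \<theta> \<in> \<Theta> \<Longrightarrow> sets (P \<theta>) = sets M"
    and "\<And>n. 1 \<le> n \<Longrightarrow> Z n \<in> measurable M N"
    and "\<And>\<theta> \<eta>. \<theta> \<in> \<Theta> \<Longrightarrow> \<eta> \<in> \<Theta> \<Longrightarrow> P \<theta> \<noteq> P \<eta> \<Longrightarrow> mutually_singular (P \<theta>) (P \<eta>)"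
    and "filtration (space M) F'"
    and "\<And>n. sets (F' n) \<subseteq> sets (natural_filtration M N Z n)"
    and "\<And>\<theta>. \<theta> \<in> \<Theta> \<Longrightarrow> test_martingale (P \<theta>) F' (S \<theta>)"
    and "\<epsilon> > 0"
  shows "\<exists>S' :: 't \<Rightarrow> nat \<Rightarrow> 'a \<Rightarrow> real.
    (\<forall>\<theta>\<in>\<Theta>. test_martingale (P \<theta>) (natural_filtration M N Z) (S' \<theta>)) \<and>
    (\<forall>\<theta>\<^sub>0\<in>\<Theta>. AE \<omega> in P \<theta>\<^sub>0.
      liminf (\<lambda>n. INF \<theta>\<in>\<Theta>. ereal (S' \<theta> n \<omega>))
        \<ge> ereal (1 - \<epsilon>) * limsup (\<lambda>n. INF \<theta>\<in>\<Theta>. ereal (S \<theta> n \<omega>)))"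
proof -
  have space: "space (P \<theta>) = space M" if "\<theta> \<in> \<Theta>" for \<theta>
    by (rule sets_eq_imp_space_eq[OF assms(4)[OF that]])
  have "\<exists>S'. test_martingale (P \<theta>) (natural_filtration M N Z) S' \<and>
      (\<forall>\<omega>\<in>space M. limsup (\<lambda>n. ereal (S \<theta> n \<omega>)) \<le> ereal (1 + \<epsilon>) * liminf (\<lambda>n. ereal (S' n \<omega>)))"
    if \<theta>: "\<theta> \<in> \<Theta>" for \<theta>
  proof -
    have "filtered_prob_space (P \<theta>) (natural_filtration M N Z)"
      by (intro filtered_prob_space_natural_filtration assms \<theta>)
    from test_martingale_refine_filtration[OF assms(9)[OF \<theta>] this assms(8) _ \<open>\<epsilon> > 0\<close>]
    show ?thesis
      by (metis natural_filtration_0 order_refl space[OF \<theta>])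
  qed
  then obtain S' where S': "\<And>\<theta>. \<theta> \<in> \<Theta> \<Longrightarrow> test_martingale (P \<theta>) (natural_filtration M N Z) (S' \<theta>)"
    and le: "\<And>\<theta> \<omega>. \<theta> \<in> \<Theta> \<Longrightarrow> \<omega> \<in> space M \<Longrightarrow>
      limsup (\<lambda>n. ereal (S \<theta> n \<omega>)) \<le> ereal (1 + \<epsilon>) * liminf (\<lambda>n. ereal (S' \<theta> n \<omega>))"
    by metis
  have "ereal (1 - \<epsilon>) * limsup (\<lambda>n. INF \<theta>\<in>\<Theta>. ereal (S \<theta> n \<omega>))
      \<le> liminf (\<lambda>n. INF \<theta>\<in>\<Theta>. ereal (S' \<theta> n \<omega>))" if \<omega>: "\<omega> \<in> space M" for \<omega>
  proof (rule le_liminf_INF_finite[OF \<open>finite \<Theta>\<close>])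
    fix \<theta> assume \<theta>: "\<theta> \<in> \<Theta>"
    define L where "L = limsup (\<lambda>n. INF \<theta>\<in>\<Theta>. ereal (S \<theta> n \<omega>))"
    define l where "l = liminf (\<lambda>n. ereal (S' \<theta> n \<omega>))"
    have "L \<le> limsup (\<lambda>n. ereal (S \<theta> n \<omega>))"
      unfolding L_def using \<theta> by (intro Limsup_mono always_eventually allI INF_lower)
    then have L_le: "L \<le> ereal (1 + \<epsilon>) * l"
      using le[OF \<theta> \<omega>] unfolding l_def by (rule order_trans)
    have "0 \<le> ereal (S \<eta> n \<omega>)" if "\<eta> \<in> \<Theta>" for \<eta> n
      using assms(9)[OF that] space[OF that] \<omega> by (simp add: test_martingale_def)
    then have "0 \<le> L"
      unfolding L_def by (intro le_Limsup always_eventually allI INF_greatest) auto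
    have "0 \<le> l"
      unfolding l_def using S'[OF \<theta>] space[OF \<theta>] \<omega>
      by (intro Liminf_bounded always_eventually) (simp add: test_martingale_def)
    \<comment> \<open>Multiplication by \<open>1 - \<epsilon>\<close> reverses inequalities when \<open>\<epsilon> > 1\<close>; then the left-hand side is
      at most 0, because \<open>L\<close> is nonnegative.\<close>
    show "ereal (1 - \<epsilon>) * L \<le> l"
    proof (cases "\<epsilon> < 1")
      case True
      then have "ereal (1 - \<epsilon>) * L \<le> ereal (1 - \<epsilon>) * (ereal (1 + \<epsilon>) * l)"
        using L_le by (intro ereal_mult_left_mono) auto
      also have "\<dots> = ereal ((1 - \<epsilon>) * (1 + \<epsilon>)) * l"
        by (simp add: mult.assoc flip: times_ereal.simps(1))
      also have "\<dots> \<le> 1 * l"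
        using \<open>0 \<le> l\<close> by (intro ereal_mult_right_mono) (auto simp: one_ereal_def algebra_simps)
      finally show ?thesis by simp
    next
      case False
      then have "ereal (1 - \<epsilon>) * L \<le> 0"
        using \<open>0 \<le> L\<close> by (simp add: ereal_mult_le_0_iff)
      then show ?thesis using \<open>0 \<le> l\<close> by (rule order_trans)
    qed
  qed
  then have "AE \<omega> in P \<theta>\<^sub>0. ereal (1 - \<epsilon>) * limsup (\<lambda>n. INF \<theta>\<in>\<Theta>. ereal (S \<theta> n \<omega>))
      \<le> liminf (\<lambda>n. INF \<theta>\<in>\<Theta>. ereal (S' \<theta> n \<omega>))" if "\<theta>\<^sub>0 \<in> \<Theta>" for \<theta>\<^sub>0
    using space[OF that] by (intro AE_I2) simp
  with S' show ?thesis by (intro exI[of _ S']) auto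
qed

end
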